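(* Let $V,\mathfrak g$ be finite-dimensional real vector spaces, $\langle\cdot,\cdot\rangle_{\mathfrak g}$ a scalar product on $\mathfrak g$ of neutral signature, and let $L=L(W,\mathcal D,\sigma,\epsilon)$ be a Dirac structure of $(V\oplus V^*\oplus\mathfrak g)^{\mathbb C}$. Let $\{v_1,\dots,v_p,w_1,\dots,w_q,v_1',\dots,v_p',\tau(w_1),\dots,\tau(w_q)\}$ be a basis of $\mathfrak g^{\mathbb C}$ adapted to $\mathcal D$, with $\epsilon_j:=\langle w_j,\tau(w_j)\rangle_{\mathfrak g}\in\{\pm1\}$, let $\mathcal C:=\mathrm{span}_{\mathbb C}\{v_i',\tau(w_j)\}$, and suppose that $\sigma$ takes values in $\mathcal C$, written as $\sigma(X)=\sum_{i=1}^p\lambda_i(X)v_i'+\sum_{j=1}^q\beta_j(X)\tau(w_j)$ for $X\in W$, with $\lambda_i,\beta_j\in W^*$. Let $\Delta:=W\cap\bar W\cap V$. Then $L$ has real index zero if and only if $W+\bar W=V^{\mathbb C}$ and one of the following situations holds: i) either $\Delta=0$ and $\mathcal D=\mathrm{span}_{\mathbb C}\{w_1,\dots,w_q\}$ (that is, $\mathcal D\cap\mathfrak g=\{0\}$); ii) or $\Delta\ne0$, $\{\mathrm{Im}(\lambda_i|_\Delta)\mid1\le i\le p\}$ are linearly independent, and $$\omega:=\mathrm{Im}\,\epsilon+\frac1{2\sqrt{-1}}\sum_j\epsilon_j\,\beta_j\wedge\bar\beta_j\in\Lambda^2\Delta^*$$ is non-degenerate on $\Delta_0:=\{X\in\Delta\mid\mathrm{Im}\,\lambda_i(X)=0,\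 1\le i\le p\}$. In particular, the dimension of $\Delta_0$ is even.
   Context: Scalar products are extended complex-bilinearly to complexifications. $V\oplus V^*\oplus\mathfrak g$ has scalar product $\langle X+\xi+r,Y+\eta+s\rangle=\frac12(\xi(Y)+\eta(X))+\langle r,s\rangle_{\mathfrak g}$. A Dirac structure is a maximal isotropic complex subspace. Every Dirac structure $L$ of $(V\oplus V^*\oplus\mathfrak g)^{\mathbb C}$ has the form $$L(W,\mathcal D,\sigma,\epsilon)=\{X+\xi+\sigma(X)+r\mid X\in W,\ \xi\in(V^{\mathbb C})^*,\ r\in\mathcal D,\ \xi(Y)=2\epsilon(X,Y)-\langle\sigma(Y),\sigma(X)+2r\rangle_{\mathfrak g}\ \forall Y\in W\}$$ with $W\subset V^{\mathbb C}$ a complex subspace, $\mathcal D\subset\mathfrak g^{\mathbb C}$ a Dirac structure, $\sigma:W\to\mathfrak g^{\mathbb C}$ complex-linear and $\epsilon\in\Lambda^2W^*$; given any complement $\mathcal C$ of $\mathcal D$, one can choose $\sigma$ (uniquely) with values in $\mathcal C$. $L$ has real index zero if $L\cap\bar L=\{0\}$. $\tau$ denotes complex conjugation of $\mathfrak g^{\mathbb C}$ with respect to $\mathfrak g$. A basis adapted to $\mathcal D$ is a basis $\{v_a,w_c,v_a',\tau(w_c)\}$ of $\mathfrak g^{\mathbb C}$ ($1\le a\le p$, $1\le c\le q$, $p+q=\frac12\dim\mathfrak g$) with $v_a,v_a'\in\mathfrak g$, $\mathcal D=\mathrm{span}_{\mathbb C}\{v_1,\dots,v_p,w_1,\dots,w_q\}$,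 whose only non-zero scalar products are $\langle v_a,v_a'\rangle_{\mathfrak g}=1$ and $\langle w_c,\tau(w_c)\rangle_{\mathfrak g}=\epsilon_c\in\{\pm1\}$. On $\Delta$, $\mathrm{Im}\,\epsilon$ and $\mathrm{Im}\,\lambda_i$ are the imaginary parts of the restrictions, $\bar\beta_j(X)=\overline{\beta_j(X)}$ for $X\in\Delta$, and $(\alpha\wedge\beta)(X,Y)=\alpha(X)\beta(Y)-\alpha(Y)\beta(X)$. *)

theory Defs
  imports "HOL-Analysis.Analysis" "HOL-Library.Function_Algebras"
begin

section \<open>Complexification of a real vector space\<close>

text \<open>The pair \<open>(x, y)\<close> stands for \<open>x + \<i> y\<close>.\<close>

type_synonym 'a cplx = "'a \<times> 'a"

definition cscale :: "complex \<Rightarrow> 'a::real_vector cplx \<Rightarrow> 'a cplx" where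
  "cscale c z = (Re c *\<^sub>R fst z - Im c *\<^sub>R snd z, Re c *\<^sub>R snd z + Im c *\<^sub>R fst z)"

definition of_vec :: "'a::real_vector \<Rightarrow> 'a cplx" where
  "of_vec x = (x, 0)"

definition conj_vec :: "'a::real_vector cplx \<Rightarrow> 'a cplx" where
  "conj_vec z = (fst z, - snd z)"

definition cbilin :: "('a::real_vector \<Rightarrow> 'a \<Rightarrow> real) \<Rightarrow> 'a cplx \<Rightarrow> 'a cplx \<Rightarrow> complex" where
  "cbilin b z w = Complex (b (fst z) (fst w) - b (snd z) (snd w))
                          (b (fst z) (snd w) + b (snd z) (fst w))"

interpretation cvec: vector_space "cscale :: complex \<Rightarrow> 'a::real_vector cplx \<Rightarrow> 'a cplx"
  by unfold_locales (auto simp: cscale_def algebra_simps prod_eq_iff)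

text \<open>Maps defined on a subspace are total functions; only their values on the subspace matter.\<close>

definition clinear_on ::
  "'a::real_vector cplx set \<Rightarrow> (complex \<Rightarrow> 'b::ab_group_add \<Rightarrow> 'b) \<Rightarrow> ('a cplx \<Rightarrow> 'b) \<Rightarrow> bool" where
  "clinear_on W s f \<longleftrightarrow>
     (\<forall>x\<in>W. \<forall>y\<in>W. f (x + y) = f x + f y) \<and> (\<forall>c. \<forall>x\<in>W. f (cscale c x) = s c (f x))"

definition alternating_form_on ::
  "'a::real_vector cplx set \<Rightarrow> ('a cplx \<Rightarrow> 'a cplx \<Rightarrow> complex) \<Rightarrow> bool" where
  "alternating_form_on W \<epsilon> \<longleftrightarrow>
     (\<forall>x\<in>W. clinear_on W (*) (\<lambda>y. \<epsilon> x y)) \<and> (\<forall>y\<in>W. clinear_on W (*) (\<lambda>x. \<epsilon> x y)) \<and>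
     (\<forall>x\<in>W. \<epsilon> x x = 0)"


section \<open>Scalar products\<close>

definition is_scalar_product :: "('g::real_vector \<Rightarrow> 'g \<Rightarrow> real) \<Rightarrow> bool" where
  "is_scalar_product b \<longleftrightarrow>
     bilinear b \<and> (\<forall>x y. b x y = b y x) \<and> (\<forall>x. (\<forall>y. b x y = 0) \<longrightarrow> x = 0)"

definition has_signature :: "('g::real_vector \<Rightarrow> 'g \<Rightarrow> real) \<Rightarrow> nat \<Rightarrow> nat \<Rightarrow> bool" where
  "has_signature b m n \<longleftrightarrow>
     (\<exists>P N. finite P \<and> finite N \<and> card P = m \<and> card N = n \<and> P \<inter> N = {} \<and>
        independent (P \<union> N) \<and> span (P \<union> N) = UNIV \<and>
        (\<forall>x\<in>P. b x x = 1) \<and> (\<forall>x\<in>N. b x x = - 1) \<and>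
        (\<forall>x\<in>P \<union> N. \<forall>y\<in>P \<union> N. x \<noteq> y \<longrightarrow> b x y = 0))"

definition neutral_signature :: "('g::real_vector \<Rightarrow> 'g \<Rightarrow> real) \<Rightarrow> bool" where
  "neutral_signature b \<longleftrightarrow> (\<exists>n. has_signature b n n)"


section \<open>Dirac structures\<close>

text \<open>\<open>S\<close> is the ambient complex vector space, with scalar multiplication \<open>s\<close> and bilinear form \<open>B\<close>.\<close>

definition isotropic_subspace ::
  "'e::ab_group_add set \<Rightarrow> (complex \<Rightarrow> 'e \<Rightarrow> 'e) \<Rightarrow> ('e \<Rightarrow> 'e \<Rightarrow> complex) \<Rightarrow> 'e set \<Rightarrow> bool" where
  "isotropic_subspace S s B L \<longleftrightarrow>
     module.subspace s L \<and> L \<subseteq> S \<and> (\<forall>x\<in>L. \<forall>y\<in>L. B x y = 0)"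

definition dirac_structure ::
  "'e::ab_group_add set \<Rightarrow> (complex \<Rightarrow> 'e \<Rightarrow> 'e) \<Rightarrow> ('e \<Rightarrow> 'e \<Rightarrow> complex) \<Rightarrow> 'e set \<Rightarrow> bool" where
  "dirac_structure S s B L \<longleftrightarrow>
     isotropic_subspace S s B L \<and> (\<forall>M. isotropic_subspace S s B M \<and> L \<subseteq> M \<longrightarrow> M = L)"

text \<open>The complexification of \<open>V \<oplus> V\<^sup>* \<oplus> \<gg>\<close>, with the complexified \<open>V\<^sup>*\<close> identified
  with the complex dual of the complexification of \<open>V\<close>. The type contains arbitrary functions in the
  second component; \<open>ecarrier\<close> restricts them to complex-linear ones.\<close>

type_synonym ('v, 'g) esp = "'v cplx \<times> ('v cplx \<Rightarrow> complex) \<times> 'g cplx"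

definition ecarrier :: "('v::real_vector, 'g::real_vector) esp set" where
  "ecarrier = {(X, \<xi>, r). Vector_Spaces.linear cscale (*) \<xi>}"

definition escale :: "complex \<Rightarrow> ('v::real_vector, 'g::real_vector) esp \<Rightarrow> ('v, 'g) esp" where
  "escale c = (\<lambda>(X, \<xi>, r). (cscale c X, (\<lambda>Y. c * \<xi> Y), cscale c r))"

definition eform :: "('g::real_vector \<Rightarrow> 'g \<Rightarrow> real) \<Rightarrow>
    ('v::real_vector, 'g) esp \<Rightarrow> ('v, 'g) esp \<Rightarrow> complex" where
  "eform b = (\<lambda>(X, \<xi>, r) (Y, \<eta>, s). (\<xi> Y + \<eta> X) / 2 + cbilin b r s)"

definition econj :: "('v::real_vector, 'g::real_vector) esp \<Rightarrow> ('v, 'g) esp" where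
  "econj = (\<lambda>(X, \<xi>, r). (conj_vec X, (\<lambda>Y. cnj (\<xi> (conj_vec Y))), conj_vec r))"

interpretation evec: vector_space
  "escale :: complex \<Rightarrow> ('v::real_vector, 'g::real_vector) esp \<Rightarrow> ('v, 'g) esp"
  by unfold_locales
    (auto simp: escale_def cscale_def fun_eq_iff algebra_simps)

definition Ldirac :: "('g::real_vector \<Rightarrow> 'g \<Rightarrow> real) \<Rightarrow> 'v::real_vector cplx set \<Rightarrow> 'g cplx set \<Rightarrow>
    ('v cplx \<Rightarrow> 'g cplx) \<Rightarrow> ('v cplx \<Rightarrow> 'v cplx \<Rightarrow> complex) \<Rightarrow> ('v, 'g) esp set" where
  "Ldirac b W D \<sigma> \<epsilon> =
     {(X, \<xi>, \<sigma> X + r) | X \<xi> r.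
        X \<in> W \<and> Vector_Spaces.linear cscale (*) \<xi> \<and> r \<in> D \<and>
        (\<forall>Y\<in>W. \<xi> Y = 2 * \<epsilon> X Y - cbilin b (\<sigma> Y) (\<sigma> X + cscale 2 r))}"

definition real_index_zero :: "('v::real_vector, 'g::real_vector) esp set \<Rightarrow> bool" where
  "real_index_zero L \<longleftrightarrow> L \<inter> econj ` L = {0}"


section \<open>Adapted bases\<close>

text \<open>The list makes the basis an indexed family, so that repetitions are excluded.\<close>

definition adapted_basis :: "('g::real_vector \<Rightarrow> 'g \<Rightarrow> real) \<Rightarrow> 'g cplx set \<Rightarrow> nat \<Rightarrow> nat \<Rightarrow>
    (nat \<Rightarrow> 'g) \<Rightarrow> (nat \<Rightarrow> 'g cplx) \<Rightarrow> (nat \<Rightarrow> 'g) \<Rightarrow> (nat \<Rightarrow> real) \<Rightarrow> bool" where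
  "adapted_basis b D p q v w v' e \<longleftrightarrow>
     2 * (p + q) = dim (UNIV :: 'g set) \<and>
     (let bs = map (of_vec \<circ> v) [1..<p + 1] @ map w [1..<q + 1]
               @ map (of_vec \<circ> v') [1..<p + 1] @ map (conj_vec \<circ> w) [1..<q + 1]
      in distinct bs \<and> cvec.independent (set bs) \<and> cvec.span (set bs) = UNIV) \<and>
     D = cvec.span ((of_vec \<circ> v) ` {1..p} \<union> w ` {1..q}) \<and>
     (\<forall>a\<in>{1..p}. \<forall>a'\<in>{1..p}.
        b (v a) (v a') = 0 \<and> b (v' a) (v' a') = 0 \<and> b (v a) (v' a') = (if a = a' then 1 else 0)) \<and>
     (\<forall>a\<in>{1..p}. \<forall>c\<in>{1..q}.
        cbilin b (of_vec (v a)) (w c) = 0 \<and> cbilin b (of_vec (v a)) (conj_vec (w c)) = 0 \<and>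
        cbilin b (of_vec (v' a)) (w c) = 0 \<and> cbilin b (of_vec (v' a)) (conj_vec (w c)) = 0) \<and>
     (\<forall>c\<in>{1..q}. \<forall>c'\<in>{1..q}.
        cbilin b (w c) (w c') = 0 \<and> cbilin b (conj_vec (w c)) (conj_vec (w c')) = 0 \<and>
        cbilin b (w c) (conj_vec (w c')) = (if c = c' then complex_of_real (e c) else 0)) \<and>
     (\<forall>c\<in>{1..q}. e c = 1 \<or> e c = - 1)"


section \<open>The real subspace \<open>\<Delta>\<close> and its two-form\<close>

definition Delta :: "'v::real_vector cplx set \<Rightarrow> 'v set" where
  "Delta W = {x. of_vec x \<in> W \<inter> conj_vec ` W}"

definition Delta0 :: "'v::real_vector cplx set \<Rightarrow> nat \<Rightarrow> (nat \<Rightarrow> 'v cplx \<Rightarrow> complex) \<Rightarrow> 'v set" where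
  "Delta0 W p lam = {x \<in> Delta W. \<forall>i\<in>{1..p}. Im (lam i (of_vec x)) = 0}"

definition independent_forms_on :: "'v set \<Rightarrow> nat \<Rightarrow> (nat \<Rightarrow> 'v \<Rightarrow> real) \<Rightarrow> bool" where
  "independent_forms_on S p f \<longleftrightarrow>
     (\<forall>c :: nat \<Rightarrow> real. (\<forall>x\<in>S. (\<Sum>i = 1..p. c i * f i x) = 0) \<longrightarrow> (\<forall>i\<in>{1..p}. c i = 0))"

definition wedge :: "('v \<Rightarrow> complex) \<Rightarrow> ('v \<Rightarrow> complex) \<Rightarrow> 'v \<Rightarrow> 'v \<Rightarrow> complex" where
  "wedge \<alpha> \<beta> x y = \<alpha> x * \<beta> y - \<alpha> y * \<beta> x"

definition omega :: "nat \<Rightarrow> (nat \<Rightarrow> real) \<Rightarrow> ('v::real_vector cplx \<Rightarrow> 'v cplx \<Rightarrow> complex) \<Rightarrow>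
    (nat \<Rightarrow> 'v cplx \<Rightarrow> complex) \<Rightarrow> 'v \<Rightarrow> 'v \<Rightarrow> complex" where
  "omega q e \<epsilon> \<beta> x y =
     complex_of_real (Im (\<epsilon> (of_vec x) (of_vec y))) +
     1 / (2 * \<i>) * (\<Sum>j = 1..q. complex_of_real (e j) *
        wedge (\<lambda>x. \<beta> j (of_vec x)) (\<lambda>x. cnj (\<beta> j (of_vec x))) x y)"

lemma omega_real: "omega q e \<epsilon> \<beta> x y \<in> \<real>"
proof -
  have "cnj (omega q e \<epsilon> \<beta> x y) = omega q e \<epsilon> \<beta> x y"
    unfolding omega_def wedge_def
    by (simp add: sum_subtractf algebra_simps add_divide_distrib diff_divide_distrib)
  then show ?thesis by (simp add: Reals_cnj_iff)
qed

definition nondegenerate_on :: "'v::zero set \<Rightarrow> ('v \<Rightarrow> 'v \<Rightarrow> complex) \<Rightarrow> bool" where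
  "nondegenerate_on S w \<longleftrightarrow> (\<forall>x\<in>S. (\<forall>y\<in>S. w x y = 0) \<longrightarrow> x = 0)"

end

theory Submission
  imports Defs
begin

text \<open>Since \<open>L \<inter> econj L\<close> is stable under conjugation, it vanishes iff \<open>L\<close> has no nonzero real
  element. In the adapted basis, a real element has the form
  \<open>x + \<xi> + \<sigma>(x) + \<Sum> a\<^sub>i v\<^sub>i + \<Sum> cnj (\<beta>\<^sub>j(x)) w\<^sub>j\<close> with \<open>x \<in> \<Delta>\<^sub>0\<close>, \<open>a\<^sub>i\<close> real, and \<open>\<xi>\<close> a real
  functional prescribed on \<open>W\<close>. Such a \<open>\<xi>\<close> is unique iff \<open>W\<close> and its conjugate span the whole
  space, and it exists iff the prescribed values are real on \<open>\<Delta>\<close>, which means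
  \<open>\<omega>(x, \<cdot>) = \<Sum> a\<^sub>i Im \<lambda>\<^sub>i\<close> on \<open>\<Delta>\<close>. A functional on \<open>\<Delta>\<close> is a combination of the \<open>Im \<lambda>\<^sub>i\<close> iff
  it vanishes on their common kernel \<open>\<Delta>\<^sub>0\<close>, so the absence of nonzero solutions \<open>(x, a)\<close> amounts to
  linear independence of the \<open>Im \<lambda>\<^sub>i\<close> together with nondegeneracy of \<open>\<omega>\<close> on \<open>\<Delta>\<^sub>0\<close>.\<close>

section \<open>Real linear algebra on subspaces\<close>

text \<open>Linearity is required only on \<open>S\<close>: the functionals studied are restrictions
  to \<Delta> of forms whose values off \<open>W\<close> carry no meaning.\<close>

definition rlinear_on :: "'a::real_vector set \<Rightarrow> ('a \<Rightarrow> real) \<Rightarrow> bool" where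
  "rlinear_on S f \<longleftrightarrow>
     (\<forall>x\<in>S. \<forall>y\<in>S. f (x + y) = f x + f y) \<and> (\<forall>c. \<forall>x\<in>S. f (c *\<^sub>R x) = c * f x)"

lemma rlinear_on_subset: "rlinear_on S f \<Longrightarrow> T \<subseteq> S \<Longrightarrow> rlinear_on T f"
  unfolding rlinear_on_def by blast

lemma rlinear_on_diff:
  assumes "rlinear_on S f" "subspace S" "x \<in> S" "y \<in> S"
  shows "f (x - y) = f x - f y"
proof -
  have "f (x + (-1) *\<^sub>R y) = f x + (-1) * f y"
    using assms subspace_scale[of S y "-1"] unfolding rlinear_on_def by metis
  then show ?thesis by simp
qed

lemma rlinear_on_0: "rlinear_on S f \<Longrightarrow> subspace S \<Longrightarrow> f 0 = 0"
  using rlinear_on_diff[of S f 0 0] subspace_0 by fastforce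

lemma rlinear_on_kernel_subspace:
  assumes "rlinear_on S f" "subspace S"
  shows "subspace {x \<in> S. f x = 0}"
  using assms rlinear_on_0[OF assms]
  by (auto simp: subspace_def rlinear_on_def)

text \<open>The values on a basis of \<open>S\<close> define a global linear map, and linearity
  carries the agreement from the basis to its span.\<close>

lemma rlinear_on_extend:
  assumes "rlinear_on S f" "subspace S"
  obtains g where "linear g" "\<And>x. x \<in> S \<Longrightarrow> g x = f x"
proof -
  obtain B where B: "B \<subseteq> S" "independent B" "S \<subseteq> span B"
    using maximal_independent_subset by blast
  obtain g :: "'a \<Rightarrow> real" where g: "linear g" "\<forall>x\<in>B. g x = f x"
    using linear_independent_extend[OF B(2)] by blast
  have eq: "span B = S" using B assms(2) by (simp add: span_subspace)
  \<comment> \<open>Membership in \<open>S\<close> is part of the induction, since \<open>f\<close>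
    is known to be linear only there.\<close>
  have "x \<in> S \<and> g x = f x" if "x \<in> span B" for x
    using that
  proof (induction rule: span_induct_alt)
    case base
    then show ?case using rlinear_on_0[OF assms] subspace_0[OF assms(2)] linear_0[OF g(1)] by simp
  next
    case (step c x y)
    then show ?case
      using B(1) g assms subspace_add[OF assms(2)] subspace_scale[OF assms(2)]
      by (auto simp: rlinear_on_def linear_add linear_scale subset_iff)
  qed
  then show ?thesis using that[OF g(1)] eq by blast
qed

text \<open>Induction on the number of forms: on the kernel of \<open>f k\<close> the remaining
  forms suffice, and one vector \<open>u\<close> outside that kernel fixes the coefficient of
  \<open>f k\<close>.\<close>

lemma rlinear_on_combination:
  assumes "finite I" "subspace S" "\<And>i. i \<in> I \<Longrightarrow> rlinear_on S (f i)" "rlinear_on S g"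
    and "\<And>x. x \<in> S \<Longrightarrow> (\<And>i. i \<in> I \<Longrightarrow> f i x = 0) \<Longrightarrow> g x = 0"
  shows "\<exists>c. \<forall>x\<in>S. g x = (\<Sum>i\<in>I. c i * f i x)"
  using assms
proof (induction I arbitrary: S rule: finite_induct)
  case empty
  then show ?case by auto
next
  case (insert k I)
  let ?K = "{x \<in> S. f k x = 0}"
  have fk: "rlinear_on S (f k)" using insert.prems by simp
  have "\<exists>c. \<forall>x\<in>?K. g x = (\<Sum>i\<in>I. c i * f i x)"
  proof (rule insert.IH)
    show "subspace ?K" using rlinear_on_kernel_subspace[OF fk] insert.prems(1) by blast
    show "rlinear_on ?K (f i)" if "i \<in> I" for i
      using that insert.prems(2) by (auto intro: rlinear_on_subset)
    show "rlinear_on ?K g" using insert.prems(3) by (auto intro: rlinear_on_subset)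
    show "g x = 0" if "x \<in> ?K" "\<And>i. i \<in> I \<Longrightarrow> f i x = 0" for x
      using that insert.prems(4)[of x] by auto
  qed
  then obtain c where c: "\<And>x. x \<in> ?K \<Longrightarrow> g x = (\<Sum>i\<in>I. c i * f i x)" by blast
  show ?case
  proof (cases "\<exists>u\<in>S. f k u \<noteq> 0")
    case False
    then have "g x = (\<Sum>i\<in>insert k I. c i * f i x)" if "x \<in> S" for x
      using c that insert.hyps by auto
    then show ?thesis by blast
  next
    case True
    then obtain u where u: "u \<in> S" "f k u \<noteq> 0" by blast
    let ?h = "\<lambda>x. g x - (\<Sum>i\<in>I. c i * f i x)"
    \<comment> \<open>\<open>?h\<close> vanishes on the kernel of \<open>f k\<close>, so it is a
      multiple of \<open>f k\<close>; evaluation at \<open>u\<close> gives the factor.\<close>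
    define c' where "c' = c(k := ?h u / f k u)"
    have "g x = (\<Sum>i\<in>insert k I. c' i * f i x)" if x: "x \<in> S" for x
    proof -
      define t where "t = f k x / f k u"
      have tu: "t *\<^sub>R u \<in> S" using u insert.prems(1) subspace_scale by blast
      have lin: "F (x - t *\<^sub>R u) = F x - t * F u" if "rlinear_on S F" for F
        using rlinear_on_diff[OF that insert.prems(1) x tu] that u by (auto simp: rlinear_on_def)
      have "x - t *\<^sub>R u \<in> ?K"
        using u tu x insert.prems(1) subspace_diff lin[OF fk] by (auto simp: t_def)
      then have "g (x - t *\<^sub>R u) = (\<Sum>i\<in>I. c i * f i (x - t *\<^sub>R u))" by (rule c)
      also have "\<dots> = (\<Sum>i\<in>I. c i * f i x - t * (c i * f i u))"
        using insert.prems(2) by (intro sum.cong) (simp_all add: lin right_diff_distrib)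
      also have "\<dots> = (\<Sum>i\<in>I. c i * f i x) - t * (\<Sum>i\<in>I. c i * f i u)"
        by (simp add: sum_subtractf sum_distrib_left)
      finally have "?h x = t * ?h u"
        using lin[OF insert.prems(3)] by (simp add: algebra_simps)
      then have "?h x = c' k * f k x" by (simp add: c'_def t_def)
      moreover have "(\<Sum>i\<in>I. c i * f i x) = (\<Sum>i\<in>I. c' i * f i x)"
        using insert.hyps by (auto intro!: sum.cong simp: c'_def)
      ultimately show ?thesis using insert.hyps by simp
    qed
    then show ?thesis by blast
  qed
qed

text \<open>Splits off a hyperbolic plane: its \<open>w\<close>-orthogonal complement
  \<open>T\<close> in \<open>S\<close> is again nondegenerate, of dimension smaller by two.\<close>

lemma skew_nondegenerate_even_dim:
  fixes S :: "'a::real_vector set"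
  assumes "subspace S" "finite B" "S \<subseteq> span B"
    and "\<And>x. x \<in> S \<Longrightarrow> rlinear_on S (w x)"
    and "\<And>x y. x \<in> S \<Longrightarrow> y \<in> S \<Longrightarrow> w x y = - w y x"
    and "\<And>x. x \<in> S \<Longrightarrow> (\<And>y. y \<in> S \<Longrightarrow> w x y = 0) \<Longrightarrow> x = 0"
  shows "even (dim S)"
  using assms
proof (induction "dim S" arbitrary: S rule: less_induct)
  case less
  note S = less.prems(1) and lin = less.prems(4) and skew = less.prems(5) and nd = less.prems(6)
  show ?case
  proof (cases "S \<subseteq> {0}")
    case True
    then have "span S = span {}" using span_mono[OF True] by (auto simp: span_0)
    then show ?thesis using dim_eq_card[of "{}" S, OF _ independent_empty] by simp
  next
    case False
    then obtain x where x: "x \<in> S" "x \<noteq> 0" by blast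
    then obtain y0 where y0: "y0 \<in> S" "w x y0 \<noteq> 0" using nd by blast
    \<comment> \<open>Rescaling makes \<open>x\<close>, \<open>y\<close> a hyperbolic pair with
      \<open>w x y = 1\<close> and \<open>w y x = - 1\<close>.\<close>
    define y where "y = (1 / w x y0) *\<^sub>R y0"
    have y: "y \<in> S" "w x y = 1"
      using S y0 lin[OF x(1)] by (auto simp: y_def subspace_scale rlinear_on_def)
    have diag: "w z z = 0" if "z \<in> S" for z using skew[OF that that] by simp
    have yx: "w y x = - 1" using skew[OF y(1) x(1)] y by simp
    define T where "T = {z \<in> {z \<in> S. w x z = 0}. w y z = 0}"
    have TS: "T \<subseteq> S" by (auto simp: T_def)
    have subT: "subspace T"
      unfolding T_def
      by (intro rlinear_on_kernel_subspace S lin x y rlinear_on_subset[OF lin[OF y(1)]]) auto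
    have lcomb: "w u (z - a *\<^sub>R x - c *\<^sub>R y) = w u z - a * w u x - c * w u y"
      if "u \<in> S" "z \<in> S" for u z a c
      using that x y S lin[OF that(1)] rlinear_on_diff[OF lin[OF that(1)] S]
      by (simp add: subspace_diff subspace_scale rlinear_on_def)
    \<comment> \<open>Projection onto \<open>T\<close> along the plane; the coefficients are forced
      by pairing with \<open>y\<close> and with \<open>x\<close>.\<close>
    have proj: "z - w z y *\<^sub>R x - w x z *\<^sub>R y \<in> T" if z: "z \<in> S" for z
      using lcomb[OF x(1) z] lcomb[OF y(1) z] x y z S yx diag skew[OF y(1) z]
      by (simp add: T_def subspace_diff subspace_scale)
    obtain C where C: "C \<subseteq> T" "independent C" "T \<subseteq> span C"
      using maximal_independent_subset by blast
    have finC: "finite C"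
      using independent_span_bound[OF less.prems(2) C(2)] C(1) TS less.prems(3) by blast
    have spanC: "span C = T" using C subT by (simp add: span_subspace)
    have dimT: "dim T = card C" using C by (intro dim_unique) auto
    have y_T: "y \<notin> span C" using spanC y by (auto simp: T_def)
    have x_T: "x \<notin> span (insert y C)"
    proof
      assume "x \<in> span (insert y C)"
      then obtain k where "x - k *\<^sub>R y \<in> T" using spanC by (auto simp: span_insert)
      then have "w y (x - k *\<^sub>R y) = 0" by (simp add: T_def)
      then show False using lcomb[OF y(1) x(1), of 0 k] yx diag[OF y(1)] by simp
    qed
    have ind: "independent (insert x (insert y C))"
      using x_T y_T C(2) by (simp add: independent_insert span_base)
    have "S \<subseteq> span (insert x (insert y C))"
    proof
      fix z assume "z \<in> S"
      then have "z - w z y *\<^sub>R x - w x z *\<^sub>R y \<in> span C" using proj spanC by blast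
      then show "z \<in> span (insert x (insert y C))" unfolding span_insert by blast
    qed
    then have "dim S = card (insert x (insert y C))"
      using ind C(1) TS x y by (intro dim_unique) auto
    also have "\<dots> = card C + 2"
      using finC x_T y_T span_base by (metis add_2_eq_Suc' card_insert_disjoint finite_insert)
    finally have dimS: "dim S = dim T + 2" using dimT by simp
    have "even (dim T)"
    proof (rule less.hyps)
      show "dim T < dim S" "subspace T" "finite B" using dimS subT less.prems(2) by auto
      show "T \<subseteq> span B" using TS less.prems(3) by blast
      show "rlinear_on T (w u)" if "u \<in> T" for u
        using that TS lin rlinear_on_subset by blast
      show "w u z = - w z u" if "u \<in> T" "z \<in> T" for u z using that TS skew by blast
      show "u = 0" if u: "u \<in> T" "\<And>z. z \<in> T \<Longrightarrow> w u z = 0" for u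
      proof (rule nd)
        show "u \<in> S" using u TS by blast
        \<comment> \<open>Modulo the plane, \<open>z\<close> lies in \<open>T\<close>; since
          \<open>u\<close> pairs to zero with \<open>x\<close>, \<open>y\<close> and all of
          \<open>T\<close>, it pairs to zero with \<open>z\<close>.\<close>
        fix z assume z: "z \<in> S"
        have "w u x = 0" "w u y = 0"
          using u(1) skew[OF \<open>u \<in> S\<close>] x y by (auto simp: T_def)
        then show "w u z = 0"
          using u(2)[OF proj[OF z]] lcomb[OF \<open>u \<in> S\<close> z] by simp
      qed
    qed
    then show ?thesis using dimS by simp
  qed
qed

section \<open>Complexifications and real functionals\<close>

lemma cscale_simps [simp]:
  "fst (cscale c z) = Re c *\<^sub>R fst z - Im c *\<^sub>R snd z"
  "snd (cscale c z) = Re c *\<^sub>R snd z + Im c *\<^sub>R fst z"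
  by (simp_all add: cscale_def)

lemma of_vec_simps [simp]: "fst (of_vec x) = x" "snd (of_vec x) = 0" "of_vec 0 = 0"
  by (simp_all add: of_vec_def zero_prod_def)

lemma conj_vec_simps [simp]:
  "fst (conj_vec z) = fst z" "snd (conj_vec z) = - snd z" "conj_vec (conj_vec z) = z"
  "conj_vec (of_vec x) = of_vec x" "conj_vec 0 = 0"
  by (simp_all add: conj_vec_def prod_eq_iff)

lemma of_vec_add: "of_vec (x + y) = of_vec x + of_vec y"
  by (simp add: prod_eq_iff)

lemma of_vec_scaleR: "of_vec (c *\<^sub>R x) = cscale (of_real c) (of_vec x)"
  by (simp add: prod_eq_iff)

lemma conj_vec_add: "conj_vec (x + y) = conj_vec x + conj_vec y"
  by (simp add: prod_eq_iff)

lemma conj_vec_cscale: "conj_vec (cscale c x) = cscale (cnj c) (conj_vec x)"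
  by (simp add: prod_eq_iff)

lemma conj_vec_sum: "conj_vec (\<Sum>i\<in>I. f i) = (\<Sum>i\<in>I. conj_vec (f i))"
  by (induction I rule: infinite_finite_induct) (simp_all add: conj_vec_add)

lemma conj_vec_fixed_iff: "conj_vec z = z \<longleftrightarrow> (\<exists>x. z = of_vec x)"
proof
  assume "conj_vec z = z"
  then have "- snd z = snd z" by (metis conj_vec_simps(2))
  then have "2 *\<^sub>R snd z = 0" unfolding scaleR_2 by (metis add.left_inverse)
  then have "z = of_vec (fst z)" by (simp add: prod_eq_iff)
  then show "\<exists>x. z = of_vec x" by blast
qed auto

text \<open>Conjugation fixes \<open>of_vec x\<close>, which therefore lies in \<open>W\<close>
  exactly when it lies in the conjugate of \<open>W\<close>.\<close>

lemma Delta_iff: "x \<in> Delta W \<longleftrightarrow> of_vec x \<in> W"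
  unfolding Delta_def by (auto intro!: image_eqI[of _ _ "of_vec x"])

lemma subspace_Delta: "cvec.subspace W \<Longrightarrow> subspace (Delta W)"
  by (auto simp: subspace_def Delta_iff of_vec_add of_vec_scaleR cvec.subspace_add
      cvec.subspace_scale cvec.subspace_0)

lemma rlinear_on_Im_clinear_on:
  assumes "clinear_on W (*) f"
  shows "rlinear_on (Delta W) (\<lambda>x. Im (f (of_vec x)))"
  using assms by (auto simp: clinear_on_def rlinear_on_def Delta_iff of_vec_add of_vec_scaleR)

lemma sum_conj_eq_UNIV_iff:
  assumes "cvec.subspace W"
  shows "{X + Y | X Y. X \<in> W \<and> Y \<in> conj_vec ` W} = UNIV \<longleftrightarrow> fst ` W = UNIV"
proof
  assume *: "{X + Y | X Y. X \<in> W \<and> Y \<in> conj_vec ` W} = UNIV"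
  show "fst ` W = UNIV"
  proof (intro set_eqI iffI UNIV_I)
    fix x
    have "of_vec x \<in> {X + Y | X Y. X \<in> W \<and> Y \<in> conj_vec ` W}" using * by simp
    then obtain X Y where "X \<in> W" "Y \<in> W" "of_vec x = X + conj_vec Y" by blast
    then have "fst (X + Y) = x" "X + Y \<in> W"
      using assms by (auto simp: prod_eq_iff cvec.subspace_add)
    then show "x \<in> fst ` W" by blast
  qed
next
  assume *: "fst ` W = UNIV"
  show "{X + Y | X Y. X \<in> W \<and> Y \<in> conj_vec ` W} = UNIV"
  proof (intro set_eqI iffI UNIV_I)
    fix z :: "'a cplx"
    have "fst z \<in> fst ` W" "snd z \<in> fst ` W" using * by simp_all
    then obtain A B where AB: "A \<in> W" "B \<in> W" "fst A = fst z" "fst B = snd z"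
      by (metis imageE)
    \<comment> \<open>\<open>?X + conj_vec ?Y\<close> equals the real part of \<open>A\<close> plus
      \<i> times the real part of \<open>B\<close>.\<close>
    let ?X = "cscale (1/2) A + cscale (\<i>/2) B" and ?Y = "cscale (1/2) A - cscale (\<i>/2) B"
    have "?X \<in> W" "?Y \<in> W"
      using AB assms by (simp_all add: cvec.subspace_add cvec.subspace_diff cvec.subspace_scale)
    moreover have "z = ?X + conj_vec ?Y"
      using AB by (simp add: prod_eq_iff flip: scaleR_left_distrib)
    ultimately show "z \<in> {X + Y | X Y. X \<in> W \<and> Y \<in> conj_vec ` W}" by blast
  qed
qed

text \<open>This is the complex-linear extension of \<open>g\<close>; all conjugation-invariant
  functionals constructed below have this form.\<close>

lemma complex_linear_of_real_linear:
  assumes "linear g"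
  shows "Vector_Spaces.linear cscale (*) (\<lambda>z. Complex (g (fst z)) (g (snd z)))"
  unfolding Vector_Spaces.linear_iff
  using assms cvec.vector_space_axioms vector_space_over_itself.vector_space_axioms
  by (auto simp: linear_add linear_diff linear_scale complex_eq_iff)

lemma subspace_fst_image:
  assumes W: "cvec.subspace W"
  shows "subspace (fst ` W)"
  unfolding subspace_def
proof (intro conjI ballI allI)
  show "0 \<in> fst ` W" using W cvec.subspace_0 by force
  show "x + y \<in> fst ` W" if "x \<in> fst ` W" "y \<in> fst ` W" for x y
  proof -
    obtain A B where "A \<in> W" "B \<in> W" "x = fst A" "y = fst B"
      using \<open>x \<in> fst ` W\<close> \<open>y \<in> fst ` W\<close> by blast
    then have "A + B \<in> W" "x + y = fst (A + B)" by (simp_all add: cvec.subspace_add[OF W])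
    then show ?thesis by blast
  qed
  show "c *\<^sub>R x \<in> fst ` W" if "x \<in> fst ` W" for c x
  proof -
    obtain A where "A \<in> W" "x = fst A" using \<open>x \<in> fst ` W\<close> by blast
    then have "cscale (of_real c) A \<in> W" "c *\<^sub>R x = fst (cscale (of_real c) A)"
      by (simp_all add: cvec.subspace_scale[OF W])
    then show ?thesis by blast
  qed
qed

text \<open>A conjugation-invariant \<xi> extends a real functional \<open>g\<close>, and agreement
  with \<open>f\<close> forces \<open>g (fst A) = Re (f A)\<close>. This is consistent because
  elements of \<open>W\<close> with equal real parts differ by \<i> times an element of \<Delta>,
  where \<open>f\<close> is real.\<close>

lemma real_extension_exists:
  assumes W: "cvec.subspace W" and f: "clinear_on W (*) f"
    and real: "\<And>y. y \<in> Delta W \<Longrightarrow> Im (f (of_vec y)) = 0"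
  obtains \<xi> where "Vector_Spaces.linear cscale (*) \<xi>" "\<And>Y. Y \<in> W \<Longrightarrow> \<xi> Y = f Y"
    "\<And>Y. cnj (\<xi> (conj_vec Y)) = \<xi> Y"
proof -
  \<comment> \<open>The choice of preimage is harmless: \<open>Re_eq\<close> shows that the value
    does not depend on it.\<close>
  define h where "h x = Re (f (SOME A. A \<in> W \<and> fst A = x))" for x
  have fadd: "f (A + B) = f A + f B" and fscale: "f (cscale c A) = c * f A"
    if "A \<in> W" "B \<in> W" for A B c
    using f that by (auto simp: clinear_on_def)
  have Re_eq: "Re (f A) = Re (f B)" if AB: "A \<in> W" "B \<in> W" "fst A = fst B" for A B
  proof -
    let ?C = "A + cscale (- 1) B"
    have C: "?C \<in> W"
      using W AB cvec.subspace_add cvec.subspace_scale by blast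
    \<comment> \<open>The difference \<open>?C\<close> is purely imaginary, so multiplying it by
      \<open>- \<i>\<close> gives a real vector of \<open>W\<close>; reality of \<open>f\<close>
      there kills \<open>Re (f ?C)\<close>.\<close>
    have "cscale (- \<i>) ?C = of_vec (snd ?C)" using AB by (simp add: prod_eq_iff)
    moreover have "cscale (- \<i>) ?C \<in> W" using W C cvec.subspace_scale by blast
    ultimately have "Im (f (cscale (- \<i>) ?C)) = 0" using real by (simp add: Delta_iff)
    then have "Re (f ?C) = 0" unfolding fscale[OF C C] by simp
    moreover have "f ?C = f A + - 1 * f B"
      using fadd[OF AB(1) cvec.subspace_scale[OF W AB(2)]] fscale[OF AB(2) AB(2)] by metis
    ultimately show ?thesis by simp
  qed
  have h: "h (fst A) = Re (f A)" if "A \<in> W" for A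
  proof -
    have "(SOME B. B \<in> W \<and> fst B = fst A) \<in> W \<and> fst (SOME B. B \<in> W \<and> fst B = fst A) = fst A"
      by (rule someI[of "\<lambda>B. B \<in> W \<and> fst B = fst A" A]) (use that in simp)
    then show ?thesis unfolding h_def using Re_eq that by blast
  qed
  note sub = subspace_fst_image[OF W]
  have "rlinear_on (fst ` W) h"
    unfolding rlinear_on_def
  proof (intro conjI ballI allI)
    fix x y assume "x \<in> fst ` W" "y \<in> fst ` W"
    then obtain A B where AB: "A \<in> W" "B \<in> W" "x = fst A" "y = fst B" by blast
    then show "h (x + y) = h x + h y"
      using h[of "A + B"] h fadd cvec.subspace_add[OF W] by simp
  next
    fix c x assume "x \<in> fst ` W"
    then obtain A where A: "A \<in> W" "x = fst A" by blast
    then show "h (c *\<^sub>R x) = c * h x"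
      using h[OF cvec.subspace_scale[OF W A(1)], of "of_real c"] h fscale by simp
  qed
  then obtain g where g: "linear g" "\<And>x. x \<in> fst ` W \<Longrightarrow> g x = h x"
    using rlinear_on_extend[OF _ sub] by blast
  show ?thesis
  proof
    show "Vector_Spaces.linear cscale (*) (\<lambda>z. Complex (g (fst z)) (g (snd z)))"
      by (rule complex_linear_of_real_linear[OF g(1)])
    show "Complex (g (fst Y)) (g (snd Y)) = f Y" if Y: "Y \<in> W" for Y
    proof -
      have iY: "cscale (- \<i>) Y \<in> W" using W Y cvec.subspace_scale by blast
      \<comment> \<open>The imaginary part of \<open>Y\<close> is the real part of
        \<open>- \<i>\<close> times \<open>Y\<close>, which again lies in \<open>W\<close>.\<close>
      have "g (snd Y) = Re (f (cscale (- \<i>) Y))"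
        using h[OF iY] g(2)[of "snd Y"] iY by (force simp: image_iff)
      then have "g (snd Y) = Im (f Y)" unfolding fscale[OF Y Y] by simp
      then show ?thesis using g(2) h Y by (simp add: complex_eq_iff)
    qed
    show "cnj (Complex (g (fst (conj_vec Y))) (g (snd (conj_vec Y)))) = Complex (g (fst Y)) (g (snd Y))"
      for Y using linear_neg[OF g(1)] by (simp add: complex_eq_iff)
  qed
qed

lemma real_annihilator_exists:
  assumes W: "cvec.subspace W" and "fst ` W \<noteq> UNIV"
  obtains \<xi> where "Vector_Spaces.linear cscale (*) \<xi>" "\<And>Y. Y \<in> W \<Longrightarrow> \<xi> Y = 0"
    "\<And>Y. cnj (\<xi> (conj_vec Y)) = \<xi> Y" "\<xi> \<noteq> 0"
proof -
  obtain u where u: "u \<notin> fst ` W" using assms by blast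
  obtain B where B: "B \<subseteq> fst ` W" "independent B" "fst ` W \<subseteq> span B"
    using maximal_independent_subset by blast
  note sub = subspace_fst_image[OF W]
  have spanB: "span B = fst ` W" using B sub by (simp add: span_subspace)
  then have "independent (insert u B)" using u B(2) by (simp add: independent_insert)
  then obtain g :: "'a \<Rightarrow> real" where g: "linear g" "\<forall>x\<in>insert u B. g x = (if x = u then 1 else 0)"
    using linear_independent_extend[of "insert u B" "\<lambda>x. if x = u then 1 else 0"] by blast
  have "\<forall>x\<in>B. g x = 0" using g(2) u B(1) by auto
  then have g0: "g x = 0" if "x \<in> fst ` W" for x
    using that linear_eq_0_on_span[OF g(1), of B] spanB by blast
  let ?\<xi> = "\<lambda>z. Complex (g (fst z)) (g (snd z))"
  show ?thesis
  proof
    show "Vector_Spaces.linear cscale (*) ?\<xi>"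
      by (rule complex_linear_of_real_linear[OF g(1)])
    show "?\<xi> Y = 0" if Y: "Y \<in> W" for Y
    proof -
      have "cscale (- \<i>) Y \<in> W" using W Y cvec.subspace_scale by blast
      then have "g (fst (cscale (- \<i>) Y)) = 0" using g0 by blast
      then show ?thesis using g0 Y by (simp add: complex_eq_iff)
    qed
    show "cnj (?\<xi> (conj_vec Y)) = ?\<xi> Y" for Y
      using linear_neg[OF g(1)] by (simp add: complex_eq_iff)
    have "?\<xi> (of_vec u) \<noteq> 0" using g(2) by (simp add: complex_eq_iff)
    then show "?\<xi> \<noteq> 0" by (metis zero_fun_apply)
  qed
qed

text \<open>By invariance \<xi> also vanishes on the conjugate of \<open>W\<close>, hence on the
  whole sum. Thus a real functional is determined by its values on \<open>W\<close>.\<close>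

lemma real_annihilator_eq_0:
  assumes W: "cvec.subspace W" and U: "fst ` W = UNIV"
    and lin: "Vector_Spaces.linear cscale (*) \<xi>" and van: "\<And>Y. Y \<in> W \<Longrightarrow> \<xi> Y = 0"
    and real: "\<And>Y. cnj (\<xi> (conj_vec Y)) = \<xi> Y"
  shows "\<xi> = 0"
proof
  fix z
  have "z \<in> {X + Y | X Y. X \<in> W \<and> Y \<in> conj_vec ` W}"
    using sum_conj_eq_UNIV_iff[OF W] U by simp
  then obtain X Y where XY: "X \<in> W" "Y \<in> W" "z = X + conj_vec Y" by blast
  have "\<xi> (conj_vec Y) = 0" using real[of Y] van XY by simp
  moreover have "\<xi> (X + conj_vec Y) = \<xi> X + \<xi> (conj_vec Y)"
    using lin unfolding Vector_Spaces.linear_iff by blast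
  ultimately show "\<xi> z = 0 z" using XY van by simp
qed

section \<open>Conjugation on the ambient space and real index zero\<close>

lemma econj_add: "econj (x + y) = econj x + econj y"
  by (simp add: econj_def conj_vec_add fun_eq_iff split_beta prod_eq_iff)

lemma econj_escale: "econj (escale c x) = escale (cnj c) (econj x)"
  by (cases x) (auto simp: econj_def escale_def conj_vec_cscale fun_eq_iff)

lemma econj_econj [simp]: "econj (econj x) = x"
  by (cases x) (auto simp: econj_def fun_eq_iff)

text \<open>If \<open>z\<close> and its conjugate \<open>u\<close> both lie in \<open>L\<close>,
  then \<open>z + u\<close> and \<i> times \<open>z - u\<close> are real elements of
  \<open>L\<close>; when both vanish, so does \<open>z\<close>.\<close>

lemma real_index_zero_iff:
  assumes L: "evec.subspace L"
  shows "real_index_zero L \<longleftrightarrow> (\<forall>z\<in>L. econj z = z \<longrightarrow> z = 0)"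
proof
  assume "real_index_zero L"
  then show "\<forall>z\<in>L. econj z = z \<longrightarrow> z = 0"
    unfolding real_index_zero_def by (metis IntI image_eqI singletonD)
next
  assume *: "\<forall>z\<in>L. econj z = z \<longrightarrow> z = 0"
  have "z = 0" if z: "z \<in> L" "u \<in> L" "z = econj u" for z u
  proof -
    have uz: "u = econj z" using z by simp
    have "z + u = 0"
      using * z L by (simp add: econj_add evec.subspace_add add.commute)
    moreover have "escale \<i> (z - u) = 0"
    proof -
      \<comment> \<open>In this form conjugation merely interchanges the two summands.\<close>
      have "escale \<i> (z - u) = escale \<i> z + escale (- \<i>) u"
        by (simp add: evec.scale_right_diff_distrib evec.scale_minus_left)
      moreover have "econj (escale \<i> z + escale (- \<i>) u) = escale \<i> z + escale (- \<i>) u"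
        unfolding econj_add econj_escale uz[symmetric] z(3)[symmetric] by (simp add: add.commute)
      moreover have "escale \<i> z + escale (- \<i>) u \<in> L"
        by (intro evec.subspace_add[OF L] evec.subspace_scale[OF L] z)
      ultimately show ?thesis using * by metis
    qed
    ultimately have "z + u = 0" "z = u" by simp_all
    then have "escale 2 z = 0" using evec.scale_left_distrib[of 1 1 z] by simp
    then show "z = 0" by simp
  qed
  moreover have "0 \<in> L \<inter> econj ` L"
    using evec.subspace_0[OF L] econj_escale[of 0 0] by (auto intro!: image_eqI[of _ _ 0])
  ultimately show "real_index_zero L" unfolding real_index_zero_def by blast
qed

section \<open>Real elements of a Dirac structure\<close>

lemma cbilin_add_left: "bilinear b \<Longrightarrow> cbilin b (x + y) z = cbilin b x z + cbilin b y z"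
  by (simp add: cbilin_def complex_eq_iff bilinear_ladd)

lemma cbilin_cscale_left: "bilinear b \<Longrightarrow> cbilin b (cscale c x) z = c * cbilin b x z"
  by (simp add: cbilin_def complex_eq_iff bilinear_ladd bilinear_lsub bilinear_lmul algebra_simps)

lemma cbilin_0_left: "bilinear b \<Longrightarrow> cbilin b 0 z = 0"
  using cbilin_cscale_left[of b 0 0 z] by simp

lemma cbilin_sum_left:
  "bilinear b \<Longrightarrow> cbilin b (\<Sum>i\<in>I. f i) z = (\<Sum>i\<in>I. cbilin b (f i) z)"
  by (induction I rule: infinite_finite_induct) (simp_all add: cbilin_add_left cbilin_0_left)

lemma cbilin_commute: "(\<And>x y. b x y = b y x) \<Longrightarrow> cbilin b z u = cbilin b u z"
  unfolding cbilin_def by (metis add.commute)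

lemma cbilin_conj: "bilinear b \<Longrightarrow> cbilin b (conj_vec x) (conj_vec y) = cnj (cbilin b x y)"
  by (simp add: cbilin_def complex_eq_iff bilinear_lneg bilinear_rneg)

lemma cbilin_of_vec: "bilinear b \<Longrightarrow> cbilin b (of_vec x) (of_vec y) = of_real (b x y)"
  by (simp add: cbilin_def complex_eq_iff bilinear_rzero bilinear_lzero)

section \<open>Dirac data in coordinates of an adapted basis\<close>

locale adapted_dirac =
  fixes b :: "'g::real_vector \<Rightarrow> 'g \<Rightarrow> real"
    and W :: "'v::real_vector cplx set"
    and D :: "'g cplx set"
    and \<sigma> :: "'v cplx \<Rightarrow> 'g cplx"
    and \<epsilon> :: "'v cplx \<Rightarrow> 'v cplx \<Rightarrow> complex"
    and p q :: nat
    and v v' :: "nat \<Rightarrow> 'g"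
    and w :: "nat \<Rightarrow> 'g cplx"
    and e :: "nat \<Rightarrow> real"
    and lam \<beta> :: "nat \<Rightarrow> 'v cplx \<Rightarrow> complex"
  assumes scalar_product: "is_scalar_product b"
    and W: "cvec.subspace W"
    and eps: "alternating_form_on W \<epsilon>"
    and adapted: "adapted_basis b D p q v w v' e"
    and lam: "\<And>i. i \<in> {1..p} \<Longrightarrow> clinear_on W (*) (lam i)"
    and beta: "\<And>j. j \<in> {1..q} \<Longrightarrow> clinear_on W (*) (\<beta> j)"
    and sigma: "\<And>X. X \<in> W \<Longrightarrow> \<sigma> X = (\<Sum>i = 1..p. cscale (lam i X) (of_vec (v' i)))
                                 + (\<Sum>j = 1..q. cscale (\<beta> j X) (conj_vec (w j)))"
begin

lemma bil: "bilinear b" and sym: "b x y = b y x"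
  using scalar_product unfolding is_scalar_product_def by blast+

lemma cbil_commute: "cbilin b z u = cbilin b u z"
  using cbilin_commute sym by blast

lemmas cbil_left = cbilin_add_left[OF bil] cbilin_sum_left[OF bil] cbilin_cscale_left[OF bil]

lemma cbil_right:
  "cbilin b z (x + y) = cbilin b z x + cbilin b z y"
  "cbilin b z (cscale c x) = c * cbilin b z x"
  "cbilin b z (\<Sum>i\<in>I. f i) = (\<Sum>i\<in>I. cbilin b z (f i))"
  by (simp_all add: cbil_commute[of z] cbil_left)

lemma pairings_v:
  assumes "a \<in> {1..p}" "a' \<in> {1..p}"
  shows "cbilin b (of_vec (v a)) (of_vec (v a')) = 0"
    "cbilin b (of_vec (v' a)) (of_vec (v' a')) = 0"
    "cbilin b (of_vec (v a)) (of_vec (v' a')) = (if a = a' then 1 else 0)"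
    "cbilin b (of_vec (v' a)) (of_vec (v a')) = (if a = a' then 1 else 0)"
  using adapted assms unfolding adapted_basis_def
  by (auto simp: cbilin_of_vec[OF bil] sym[of "v' a"])

lemma pairings_vw:
  assumes "a \<in> {1..p}" "c \<in> {1..q}"
  shows "cbilin b (of_vec (v a)) (w c) = 0" "cbilin b (of_vec (v a)) (conj_vec (w c)) = 0"
    "cbilin b (of_vec (v' a)) (w c) = 0" "cbilin b (of_vec (v' a)) (conj_vec (w c)) = 0"
    "cbilin b (w c) (of_vec (v a)) = 0" "cbilin b (conj_vec (w c)) (of_vec (v a)) = 0"
    "cbilin b (w c) (of_vec (v' a)) = 0" "cbilin b (conj_vec (w c)) (of_vec (v' a)) = 0"
  using adapted assms unfolding adapted_basis_def
  by (simp_all add: cbil_commute[of "w c"] cbil_commute[of "conj_vec (w c)"])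

lemma pairings_w:
  assumes "c \<in> {1..q}" "c' \<in> {1..q}"
  shows "cbilin b (w c) (w c') = 0" "cbilin b (conj_vec (w c)) (conj_vec (w c')) = 0"
    "cbilin b (w c) (conj_vec (w c')) = (if c = c' then of_real (e c) else 0)"
    "cbilin b (conj_vec (w c)) (w c') = (if c = c' then of_real (e c) else 0)"
  using adapted assms unfolding adapted_basis_def
  by (auto simp: cbil_commute[of "conj_vec (w c)" "w c'"])

lemma e_nonzero: "j \<in> {1..q} \<Longrightarrow> e j \<noteq> 0"
  using adapted unfolding adapted_basis_def by fastforce

text \<open>Coordinates on \<open>D\<close>; only the values of \<open>a\<close> on
  \<open>{1..p}\<close> and of \<open>c\<close> on \<open>{1..q}\<close> matter.\<close>

definition dvec :: "(nat \<Rightarrow> complex) \<Rightarrow> (nat \<Rightarrow> complex) \<Rightarrow> 'g cplx" where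
  "dvec a c = (\<Sum>i = 1..p. cscale (a i) (of_vec (v i))) + (\<Sum>j = 1..q. cscale (c j) (w j))"

lemma D_span: "D = cvec.span ((of_vec \<circ> v) ` {1..p} \<union> w ` {1..q})"
  using adapted unfolding adapted_basis_def by blast

lemma dvec_in_D: "dvec a c \<in> D"
  unfolding D_span dvec_def
  by (intro cvec.span_add cvec.span_sum cvec.span_scale cvec.span_base) auto

lemma D_imp_dvec:
  assumes "r \<in> D"
  obtains a c where "r = dvec a c"
proof -
  have "\<exists>a c. r = dvec a c"
    using assms unfolding D_span
  proof (induction rule: cvec.span_induct_alt)
    case base
    have "0 = dvec (\<lambda>_. 0) (\<lambda>_. 0)" by (simp add: dvec_def)
    then show ?case by blast
  next
    case (step k x y)
    then obtain a c where y: "y = dvec a c" by blast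
    from step(1) consider i where "i \<in> {1..p}" "x = of_vec (v i)" | j where "j \<in> {1..q}" "x = w j"
      by auto
    then show ?case
    proof cases
      case 1
      have "(\<Sum>l = 1..p. cscale ((a(i := a i + k)) l) (of_vec (v l))) =
            (\<Sum>l = 1..p. cscale (a l) (of_vec (v l)) + (if l = i then cscale k (of_vec (v i)) else 0))"
        by (intro sum.cong) (auto simp: cvec.scale_left_distrib)
      also have "\<dots> = (\<Sum>l = 1..p. cscale (a l) (of_vec (v l))) + cscale k (of_vec (v i))"
        using 1 by (simp add: sum.distrib)
      finally have "cscale k x + y = dvec (a(i := a i + k)) c"
        using 1 y by (simp add: dvec_def add_ac)
      then show ?thesis by blast
    next
      case 2
      have "(\<Sum>l = 1..q. cscale ((c(j := c j + k)) l) (w l)) =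
            (\<Sum>l = 1..q. cscale (c l) (w l) + (if l = j then cscale k (w j) else 0))"
        by (intro sum.cong) (auto simp: cvec.scale_left_distrib)
      also have "\<dots> = (\<Sum>l = 1..q. cscale (c l) (w l)) + cscale k (w j)"
        using 2 by (simp add: sum.distrib)
      finally have "cscale k x + y = dvec a (c(j := c j + k))"
        using 2 y by (simp add: dvec_def add_ac)
      then show ?thesis by blast
    qed
  qed
  then show ?thesis using that by blast
qed

text \<open>The vectors \<open>v' i\<close> and \<open>conj_vec (w j)\<close> are dual to the
  generators of \<open>D\<close> up to the signs \<open>e j\<close>, so they read off coordinates;
  the other pairings vanish since \<open>D\<close> is isotropic.\<close>

lemma pairings_dvec:
  "i \<in> {1..p} \<Longrightarrow> cbilin b (dvec a c) (of_vec (v' i)) = a i"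
  "i \<in> {1..p} \<Longrightarrow> cbilin b (dvec a c) (of_vec (v i)) = 0"
  "j \<in> {1..q} \<Longrightarrow> cbilin b (dvec a c) (conj_vec (w j)) = of_real (e j) * c j"
  "j \<in> {1..q} \<Longrightarrow> cbilin b (dvec a c) (w j) = 0"
  unfolding dvec_def
  by (simp_all add: cbil_left pairings_v pairings_vw pairings_w if_distrib cong: if_cong)

lemma pairings_sigma:
  assumes "X \<in> W"
  shows "i \<in> {1..p} \<Longrightarrow> cbilin b (\<sigma> X) (of_vec (v' i)) = 0"
  "i \<in> {1..p} \<Longrightarrow> cbilin b (\<sigma> X) (of_vec (v i)) = lam i X"
  "j \<in> {1..q} \<Longrightarrow> cbilin b (\<sigma> X) (conj_vec (w j)) = 0"
  "j \<in> {1..q} \<Longrightarrow> cbilin b (\<sigma> X) (w j) = e j * \<beta> j X"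
  unfolding sigma[OF assms]
  by (simp_all add: cbil_left pairings_v pairings_vw pairings_w if_distrib cong: if_cong)

lemma cbil_sigma_dvec:
  assumes "X \<in> W"
  shows "cbilin b (\<sigma> X) (dvec a c) = (\<Sum>i = 1..p. a i * lam i X) + (\<Sum>j = 1..q. e j * \<beta> j X * c j)"
  unfolding dvec_def using assms by (simp add: cbil_right pairings_sigma mult_ac)

text \<open>The complement C spanned by the \<open>v' i\<close> and \<open>conj_vec (w j)\<close> is
  isotropic, so the term quadratic in \<sigma> drops out of the condition defining
  \<open>Ldirac\<close>.\<close>

lemma cbil_sigma_sigma:
  assumes "X \<in> W" "Y \<in> W"
  shows "cbilin b (\<sigma> Y) (\<sigma> X) = 0"
  unfolding sigma[OF assms(1)] using assms(2) by (simp add: cbil_right pairings_sigma)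

text \<open>For a real vector, pairing with \<open>conj_vec u\<close> is conjugate to pairing with
  \<open>u\<close>. Testing \<open>u\<close> on \<open>v i\<close>, \<open>v' i\<close> and
  \<open>w j\<close> gives reality of \<open>lam i X\<close>, reality of \<open>a i\<close>, and the
  value of \<open>c j\<close>.\<close>

lemma sigma_dvec_real_iff:
  assumes X: "X \<in> W"
  shows "conj_vec (\<sigma> X + dvec a c) = \<sigma> X + dvec a c \<longleftrightarrow>
    (\<forall>i\<in>{1..p}. Im (lam i X) = 0 \<and> Im (a i) = 0) \<and> (\<forall>j\<in>{1..q}. c j = cnj (\<beta> j X))"
proof
  let ?s = "\<sigma> X + dvec a c"
  assume fixed: "conj_vec ?s = ?s"
  have cb: "cbilin b ?s (conj_vec u) = cnj (cbilin b ?s u)" for u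
    using cbilin_conj[OF bil, of ?s u] fixed by simp
  have "Im (lam i X) = 0 \<and> Im (a i) = 0" if "i \<in> {1..p}" for i
    using that X cb[of "of_vec (v i)"] cb[of "of_vec (v' i)"]
    by (simp add: cbil_left pairings_sigma pairings_dvec complex_eq_iff)
  moreover have "c j = cnj (\<beta> j X)" if "j \<in> {1..q}" for j
    using that X cb[of "w j"] e_nonzero[OF that]
    by (simp add: cbil_left pairings_sigma pairings_dvec)
  ultimately show "(\<forall>i\<in>{1..p}. Im (lam i X) = 0 \<and> Im (a i) = 0) \<and>
    (\<forall>j\<in>{1..q}. c j = cnj (\<beta> j X))" by blast
next
  assume real: "(\<forall>i\<in>{1..p}. Im (lam i X) = 0 \<and> Im (a i) = 0) \<and> (\<forall>j\<in>{1..q}. c j = cnj (\<beta> j X))"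
  then have eqs: "i \<in> {1..p} \<Longrightarrow> cnj (lam i X) = lam i X" "i \<in> {1..p} \<Longrightarrow> cnj (a i) = a i" for i
    by (simp_all add: complex_eq_iff)
  \<comment> \<open>Conjugation keeps the sums over \<open>v i\<close> and \<open>v' i\<close> and
    interchanges those over \<open>w j\<close> and \<open>conj_vec (w j)\<close>.\<close>
  show "conj_vec (\<sigma> X + dvec a c) = \<sigma> X + dvec a c"
    unfolding sigma[OF X] dvec_def
    using real eqs by (simp add: conj_vec_add conj_vec_sum conj_vec_cscale add_ac)
qed

text \<open>The values that \<open>Ldirac\<close> prescribes for \<xi> on \<open>W\<close> when the
  vector part is \<open>of_vec x\<close> and the \<open>D\<close>-part has coordinates
  \<open>a i\<close> and \<open>cnj (\<beta> j (of_vec x))\<close>.\<close>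

definition phi :: "'v \<Rightarrow> (nat \<Rightarrow> real) \<Rightarrow> 'v cplx \<Rightarrow> complex" where
  "phi x a Y = 2 * (\<epsilon> (of_vec x) Y - (\<Sum>i = 1..p. a i * lam i Y)
     - (\<Sum>j = 1..q. e j * \<beta> j Y * cnj (\<beta> j (of_vec x))))"

lemma clinear_on_phi:
  assumes "x \<in> Delta W"
  shows "clinear_on W (*) (phi x a)"
proof -
  have "clinear_on W (*) (\<epsilon> (of_vec x))"
    using eps assms unfolding alternating_form_on_def Delta_iff by blast
  then show ?thesis
    using lam beta unfolding clinear_on_def phi_def
    by (simp add: sum.distrib sum_distrib_left sum_subtractf algebra_simps)
qed

text \<open>The origin of \<omega>: the wedge of \<open>\<beta> j\<close> with its conjugate is a
  number minus its conjugate, so division by \<open>2 * \<i>\<close> leaves an imaginary part.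
  Reality of \<open>phi x a\<close> on \<Delta> thus becomes a real linear equation for
  \<open>a\<close>.\<close>

lemma Im_phi:
  "Im (phi x a (of_vec y)) = 2 * (Re (omega q e \<epsilon> \<beta> x y) - (\<Sum>i = 1..p. a i * Im (lam i (of_vec y))))"
proof -
  have "Re (1 / (2 * \<i>) * (complex_of_real k * (s * cnj t - t * cnj s))) = - Im (k * t * cnj s)"
    for k s t by (simp add: Re_divide Im_divide field_simps)
  then have "Re (omega q e \<epsilon> \<beta> x y) = Im (\<epsilon> (of_vec x) (of_vec y))
      - (\<Sum>j = 1..q. Im (e j * \<beta> j (of_vec y) * cnj (\<beta> j (of_vec x))))"
    unfolding omega_def wedge_def sum_distrib_left
    by (simp only: plus_complex.sel Re_complex_of_real Re_sum sum_negf)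
  then show ?thesis unfolding phi_def by simp
qed

text \<open>Being fixed by conjugation is checked in each component. The last one is governed by
  \<open>sigma_dvec_real_iff\<close>, which puts \<open>x\<close> in \<open>Delta0\<close> and
  leaves only real coefficients \<open>a\<close> free.\<close>

lemma Ldirac_real_iff:
  "z \<in> Ldirac b W D \<sigma> \<epsilon> \<and> econj z = z \<longleftrightarrow>
    (\<exists>x\<in>Delta0 W p lam. \<exists>a :: nat \<Rightarrow> real. \<exists>\<xi>.
       z = (of_vec x, \<xi>, \<sigma> (of_vec x) + dvec (\<lambda>i. of_real (a i)) (\<lambda>j. cnj (\<beta> j (of_vec x)))) \<and>
       Vector_Spaces.linear cscale (*) \<xi> \<and> (\<forall>Y. cnj (\<xi> (conj_vec Y)) = \<xi> Y) \<and>
       (\<forall>Y\<in>W. \<xi> Y = phi x a Y))" (is "?L \<longleftrightarrow> ?R")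
proof
  assume z: ?L
  then obtain X \<xi> r where X: "X \<in> W" and r: "r \<in> D" and lin: "Vector_Spaces.linear cscale (*) \<xi>"
    and zeq: "z = (X, \<xi>, \<sigma> X + r)"
    and xi: "\<And>Y. Y \<in> W \<Longrightarrow> \<xi> Y = 2 * \<epsilon> X Y - cbilin b (\<sigma> Y) (\<sigma> X + cscale 2 r)"
    unfolding Ldirac_def by blast
  obtain a c where rd: "r = dvec a c" using D_imp_dvec[OF r] .
  have fixed: "conj_vec X = X" "(\<lambda>Y. cnj (\<xi> (conj_vec Y))) = \<xi>" "conj_vec (\<sigma> X + r) = \<sigma> X + r"
    using z zeq by (auto simp: econj_def)
  obtain x where x: "X = of_vec x" using fixed(1) conj_vec_fixed_iff by blast
  have real: "Im (lam i X) = 0" "Im (a i) = 0" if "i \<in> {1..p}" for i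
    using that fixed(3) sigma_dvec_real_iff[OF X] rd by auto
  have c: "c j = cnj (\<beta> j X)" if "j \<in> {1..q}" for j
    using that fixed(3) sigma_dvec_real_iff[OF X] rd by auto
  have "x \<in> Delta0 W p lam" using x X real by (auto simp: Delta0_def Delta_iff)
  \<comment> \<open>The old and new coefficients agree on the index ranges of the sums, which is all
    that \<open>dvec\<close> sees.\<close>
  moreover have r': "r = dvec (\<lambda>i. of_real (Re (a i))) (\<lambda>j. cnj (\<beta> j (of_vec x)))"
    unfolding rd dvec_def using real c x
    by (intro arg_cong2[where f = "(+)"] sum.cong) (auto simp: complex_eq_iff)
  moreover have "\<xi> Y = phi x (\<lambda>i. Re (a i)) Y" if "Y \<in> W" for Y
    using xi[OF that] cbil_sigma_sigma[OF X that] cbil_sigma_dvec[OF that] x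
    by (simp add: r' cbil_right phi_def algebra_simps)
  ultimately show ?R using zeq x lin fixed(2) by (metis (mono_tags))
next
  assume ?R
  then obtain x a \<xi> where x: "x \<in> Delta0 W p lam"
    and zeq: "z = (of_vec x, \<xi>, \<sigma> (of_vec x) + dvec (\<lambda>i. of_real (a i)) (\<lambda>j. cnj (\<beta> j (of_vec x))))"
    and lin: "Vector_Spaces.linear cscale (*) \<xi>" and real: "\<forall>Y. cnj (\<xi> (conj_vec Y)) = \<xi> Y"
    and xi: "\<forall>Y\<in>W. \<xi> Y = phi x a Y" by blast
  let ?r = "dvec (\<lambda>i. of_real (a i)) (\<lambda>j. cnj (\<beta> j (of_vec x)))"
  have X: "of_vec x \<in> W" using x by (simp add: Delta0_def Delta_iff)
  have "\<xi> Y = 2 * \<epsilon> (of_vec x) Y - cbilin b (\<sigma> Y) (\<sigma> (of_vec x) + cscale 2 ?r)" if "Y \<in> W" for Y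
    using xi that cbil_sigma_sigma[OF X that] cbil_sigma_dvec[OF that]
    by (simp add: cbil_right phi_def algebra_simps)
  then have "z \<in> Ldirac b W D \<sigma> \<epsilon>"
    unfolding Ldirac_def using zeq X lin dvec_in_D by blast
  moreover have "conj_vec (\<sigma> (of_vec x) + ?r) = \<sigma> (of_vec x) + ?r"
    using x by (simp add: sigma_dvec_real_iff[OF X] Delta0_def)
  ultimately show ?L using zeq real by (simp add: econj_def fun_eq_iff)
qed

section \<open>The linear system describing real elements\<close>

lemma subspace_Delta0: "subspace (Delta0 W p lam)"
proof -
  \<comment> \<open>The separate factor \<open>Delta W\<close> matters for \<open>p = 0\<close>,
    when the indexed intersection is the whole space.\<close>
  have "Delta0 W p lam = Delta W \<inter> (\<Inter>i\<in>{1..p}. {x \<in> Delta W. Im (lam i (of_vec x)) = 0})"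
    by (auto simp: Delta0_def)
  moreover have "subspace {x \<in> Delta W. Im (lam i (of_vec x)) = 0}" if "i \<in> {1..p}" for i
    using rlinear_on_kernel_subspace[OF rlinear_on_Im_clinear_on[OF lam[OF that]] subspace_Delta[OF W]] .
  ultimately show ?thesis
    by (simp add: subspace_inter subspace_Delta[OF W] subspace_Inter)
qed

lemma lam_beta_0:
  "i \<in> {1..p} \<Longrightarrow> lam i 0 = 0" "j \<in> {1..q} \<Longrightarrow> \<beta> j 0 = 0"
proof -
  have *: "f 0 = 0" if "clinear_on W (*) f" for f :: "'v cplx \<Rightarrow> complex"
  proof -
    have "f (cscale 0 0) = 0 * f 0"
      using that cvec.subspace_0[OF W] unfolding clinear_on_def by blast
    then show ?thesis by simp
  qed
  show "i \<in> {1..p} \<Longrightarrow> lam i 0 = 0" "j \<in> {1..q} \<Longrightarrow> \<beta> j 0 = 0"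
    using * lam beta by blast+
qed

lemma eps_0:
  assumes "Y \<in> W"
  shows "\<epsilon> 0 Y = 0"
proof -
  have "clinear_on W (*) (\<lambda>x. \<epsilon> x Y)" using eps assms by (simp add: alternating_form_on_def)
  then have "\<epsilon> (cscale 0 0) Y = 0 * \<epsilon> 0 Y"
    using cvec.subspace_0[OF W] unfolding clinear_on_def by blast
  then show ?thesis by simp
qed

lemma sigma_0: "\<sigma> 0 = 0"
  using sigma[OF cvec.subspace_0[OF W]] by (simp add: lam_beta_0)

lemma real_index_zero_iff_no_solution:
  assumes "evec.subspace (Ldirac b W D \<sigma> \<epsilon>)"
  shows "real_index_zero (Ldirac b W D \<sigma> \<epsilon>) \<longleftrightarrow> fst ` W = UNIV \<and>
    (\<forall>x\<in>Delta0 W p lam. \<forall>a :: nat \<Rightarrow> real.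
      (\<forall>y\<in>Delta W. Re (omega q e \<epsilon> \<beta> x y) = (\<Sum>i = 1..p. a i * Im (lam i (of_vec y)))) \<longrightarrow>
      x = 0 \<and> (\<forall>i\<in>{1..p}. a i = 0))" (is "_ \<longleftrightarrow> _ \<and> ?N")
  unfolding real_index_zero_iff[OF assms]
proof (intro iffI conjI)
  let ?d = "\<lambda>x a. dvec (\<lambda>i. of_real (a i)) (\<lambda>j. cnj (\<beta> j (of_vec x)))"
  assume "\<forall>z\<in>Ldirac b W D \<sigma> \<epsilon>. econj z = z \<longrightarrow> z = 0"
  then have zero: "(of_vec x, \<xi>, \<sigma> (of_vec x) + ?d x a) = 0"
    if "x \<in> Delta0 W p lam" "Vector_Spaces.linear cscale (*) \<xi>"
      "\<And>Y. cnj (\<xi> (conj_vec Y)) = \<xi> Y" "\<And>Y. Y \<in> W \<Longrightarrow> \<xi> Y = phi x a Y" for x \<xi> a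
    using Ldirac_real_iff[of "(of_vec x, \<xi>, \<sigma> (of_vec x) + ?d x a)"] that by blast
  show "fst ` W = UNIV"
  proof (rule ccontr)
    assume "fst ` W \<noteq> UNIV"
    then obtain \<xi> where xi: "Vector_Spaces.linear cscale (*) \<xi>" "\<And>Y. Y \<in> W \<Longrightarrow> \<xi> Y = 0"
      "\<And>Y. cnj (\<xi> (conj_vec Y)) = \<xi> Y" "\<xi> \<noteq> 0"
      using real_annihilator_exists[OF W] by blast
    \<comment> \<open>The zero pair prescribes the zero functional on \<open>W\<close>, so the
      annihilator \<xi> alone forms a nonzero real element.\<close>
    have "phi 0 (\<lambda>_. 0) Y = 0" if "Y \<in> W" for Y
      using eps_0[OF that] by (simp add: phi_def lam_beta_0)
    then show False
      using zero[of 0 \<xi> "\<lambda>_. 0"] xi subspace_0[OF subspace_Delta0] by (simp add: prod_eq_iff)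
  qed
  show ?N
  proof (intro ballI allI impI)
    fix x and a :: "nat \<Rightarrow> real"
    assume x: "x \<in> Delta0 W p lam"
      and eq: "\<forall>y\<in>Delta W. Re (omega q e \<epsilon> \<beta> x y) = (\<Sum>i = 1..p. a i * Im (lam i (of_vec y)))"
    have "x \<in> Delta W" using x by (simp add: Delta0_def)
    moreover have "Im (phi x a (of_vec y)) = 0" if "y \<in> Delta W" for y
      using eq that by (simp add: Im_phi)
    ultimately obtain \<xi> where "Vector_Spaces.linear cscale (*) \<xi>" "\<And>Y. Y \<in> W \<Longrightarrow> \<xi> Y = phi x a Y"
      "\<And>Y. cnj (\<xi> (conj_vec Y)) = \<xi> Y"
      using real_extension_exists[OF W clinear_on_phi] by blast
    then have z: "(of_vec x, \<xi>, \<sigma> (of_vec x) + ?d x a) = 0" using zero x by blast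
    then have x0: "x = 0" by (simp add: prod_eq_iff)
    have "?d x a = 0" using z by (simp add: prod_eq_iff x0 sigma_0)
    \<comment> \<open>Pairing with \<open>v' i\<close> recovers \<open>a i\<close> from the
      vanishing \<open>D\<close>-part.\<close>
    then have "a i = 0" if "i \<in> {1..p}" for i
      using pairings_dvec(1)[OF that, of "\<lambda>i. of_real (a i)" "\<lambda>j. cnj (\<beta> j (of_vec x))"]
      by (simp add: cbilin_0_left[OF bil])
    then show "x = 0 \<and> (\<forall>i\<in>{1..p}. a i = 0)" using x0 by blast
  qed
next
  assume N: "fst ` W = UNIV \<and> ?N"
  show "\<forall>z\<in>Ldirac b W D \<sigma> \<epsilon>. econj z = z \<longrightarrow> z = 0"
  proof (intro ballI impI)
    fix z assume "z \<in> Ldirac b W D \<sigma> \<epsilon>" "econj z = z"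
    then obtain x and a :: "nat \<Rightarrow> real" and \<xi> where x: "x \<in> Delta0 W p lam"
      and zeq: "z = (of_vec x, \<xi>, \<sigma> (of_vec x) + dvec (\<lambda>i. of_real (a i)) (\<lambda>j. cnj (\<beta> j (of_vec x))))"
      and lin: "Vector_Spaces.linear cscale (*) \<xi>" and real: "\<And>Y. cnj (\<xi> (conj_vec Y)) = \<xi> Y"
      and xi: "\<And>Y. Y \<in> W \<Longrightarrow> \<xi> Y = phi x a Y"
      using iffD1[OF Ldirac_real_iff] by blast
    \<comment> \<open>A conjugation-invariant \<xi> is real on real vectors, so the imaginary part
      of \<open>phi x a\<close> vanishes on \<Delta>.\<close>
    have "Re (omega q e \<epsilon> \<beta> x y) = (\<Sum>i = 1..p. a i * Im (lam i (of_vec y)))" if "y \<in> Delta W" for y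
      using Im_phi[of x a y] xi[of "of_vec y"] that real[of "of_vec y"]
      by (simp add: Delta_iff complex_eq_iff)
    then have x0: "x = 0" and a0: "\<forall>i\<in>{1..p}. a i = 0" using N x by blast+
    have r0: "dvec (\<lambda>i. of_real (a i)) (\<lambda>j. cnj (\<beta> j (of_vec x))) = 0"
      using x0 a0 by (simp add: dvec_def lam_beta_0)
    have "\<xi> Y = 0" if "Y \<in> W" for Y
      using xi[OF that] x0 a0 eps_0[OF that] by (simp add: phi_def lam_beta_0)
    then have "\<xi> = 0" using real_annihilator_eq_0[OF W _ lin _ real] N by blast
    then show "z = 0" using zeq r0 x0 by (simp add: sigma_0 prod_eq_iff)
  qed
qed

text \<open>Up to a factor 2, this is the imaginary part of \<open>phi\<close> with zero
  coefficients, whose linearity is known.\<close>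

lemma rlinear_on_omega:
  assumes "x \<in> Delta W"
  shows "rlinear_on (Delta W) (\<lambda>y. Re (omega q e \<epsilon> \<beta> x y))"
proof -
  have "Re (omega q e \<epsilon> \<beta> x y) = Im (phi x (\<lambda>_. 0) (of_vec y)) / 2" for y
    by (simp add: Im_phi)
  then have "(\<lambda>y. Re (omega q e \<epsilon> \<beta> x y)) = (\<lambda>y. Im (phi x (\<lambda>_. 0) (of_vec y)) / 2)"
    by blast
  then show ?thesis
    using rlinear_on_Im_clinear_on[OF clinear_on_phi[OF assms, of "\<lambda>_. 0"]]
    by (simp add: rlinear_on_def add_divide_distrib)
qed

lemma omega_skew:
  assumes "x \<in> Delta W" "y \<in> Delta W"
  shows "omega q e \<epsilon> \<beta> x y = - omega q e \<epsilon> \<beta> y x"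
proof -
  let ?x = "of_vec x" and ?y = "of_vec y"
  have xy: "?x \<in> W" "?y \<in> W" "?x + ?y \<in> W" using assms W by (simp_all add: Delta_iff cvec.subspace_add)
  have add: "\<epsilon> u (s + t) = \<epsilon> u s + \<epsilon> u t" "\<epsilon> (s + t) u = \<epsilon> s u + \<epsilon> t u" "\<epsilon> u u = 0"
    if "u \<in> W" "s \<in> W" "t \<in> W" for u s t
    using eps that unfolding alternating_form_on_def clinear_on_def by blast+
  \<comment> \<open>Polarization at \<open>?x + ?y\<close>: alternation is given as vanishing on the
    diagonal.\<close>
  have "\<epsilon> ?x ?y + \<epsilon> ?y ?x = 0"
    using add(3)[OF xy(3) xy(3) xy(3)] add(1)[OF xy(3) xy(1,2)] add(2)[OF xy(1) xy(1,2)]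
      add(2)[OF xy(2) xy(1,2)] add(3)[OF xy(1) xy(1) xy(1)] add(3)[OF xy(2) xy(2) xy(2)]
    by (simp add: add.commute)
  then have "\<epsilon> ?x ?y = - \<epsilon> ?y ?x" by (simp add: eq_neg_iff_add_eq_0)
  moreover have "wedge f g x y = - wedge f g y x" for f g :: "'v \<Rightarrow> complex"
    by (simp add: wedge_def)
  ultimately show ?thesis
    unfolding omega_def by (simp add: sum_negf)
qed

lemma omega_0:
  assumes "y \<in> Delta W"
  shows "omega q e \<epsilon> \<beta> 0 y = 0"
  using eps_0[of "of_vec y"] assms
  by (simp add: omega_def wedge_def lam_beta_0 Delta_iff)

lemma omega_eq_0_iff: "omega q e \<epsilon> \<beta> x y = 0 \<longleftrightarrow> Re (omega q e \<epsilon> \<beta> x y) = 0"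
  using omega_real[of q e \<epsilon> \<beta> x y] by (simp add: complex_is_Real_iff complex_eq_iff)

text \<open>Solutions with \<open>x = 0\<close> are the linear relations among the \<open>Im\<close>
  of the \<open>lam i\<close>. A general \<open>x\<close> in \<open>Delta0\<close> admits some
  \<open>a\<close> exactly when \<open>omega\<close> at \<open>x\<close> vanishes on
  \<open>Delta0\<close>, the common kernel of these forms.\<close>

lemma no_solution_iff:
  "(\<forall>x\<in>Delta0 W p lam. \<forall>a :: nat \<Rightarrow> real.
      (\<forall>y\<in>Delta W. Re (omega q e \<epsilon> \<beta> x y) = (\<Sum>i = 1..p. a i * Im (lam i (of_vec y)))) \<longrightarrow>
      x = 0 \<and> (\<forall>i\<in>{1..p}. a i = 0)) \<longleftrightarrow>
   independent_forms_on (Delta W) p (\<lambda>i x. Im (lam i (of_vec x))) \<and>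
   nondegenerate_on (Delta0 W p lam) (omega q e \<epsilon> \<beta>)" (is "?N \<longleftrightarrow> ?I \<and> ?G")
proof (intro iffI conjI)
  assume N: ?N
  show ?I
    unfolding independent_forms_on_def
    using N omega_0 subspace_0[OF subspace_Delta0] by auto
  show ?G
    unfolding nondegenerate_on_def
  proof (intro ballI impI)
    fix x assume x: "x \<in> Delta0 W p lam" and van: "\<forall>y\<in>Delta0 W p lam. omega q e \<epsilon> \<beta> x y = 0"
    have "x \<in> Delta W" using x by (simp add: Delta0_def)
    \<comment> \<open>The functional vanishes on the common kernel of the forms, so
      \<open>rlinear_on_combination\<close> supplies the coefficients.\<close>
    then have "\<exists>a. \<forall>y\<in>Delta W. Re (omega q e \<epsilon> \<beta> x y) = (\<Sum>i = 1..p. a i * Im (lam i (of_vec y)))"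
      using van
      by (intro rlinear_on_combination[OF _ subspace_Delta[OF W]] rlinear_on_omega
          rlinear_on_Im_clinear_on lam) (auto simp: Delta0_def)
    then show "x = 0" using N x by blast
  qed
next
  assume IG: "?I \<and> ?G"
  show ?N
  proof (intro ballI allI impI)
    fix x and a :: "nat \<Rightarrow> real"
    assume x: "x \<in> Delta0 W p lam"
      and eq: "\<forall>y\<in>Delta W. Re (omega q e \<epsilon> \<beta> x y) = (\<Sum>i = 1..p. a i * Im (lam i (of_vec y)))"
    have "omega q e \<epsilon> \<beta> x y = 0" if "y \<in> Delta0 W p lam" for y
      using eq that by (simp add: omega_eq_0_iff Delta0_def)
    then have x0: "x = 0" using IG x unfolding nondegenerate_on_def by blast
    have "\<forall>i\<in>{1..p}. a i = 0"
      using IG eq x0 omega_0 unfolding independent_forms_on_def by simp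
    then show "x = 0 \<and> (\<forall>i\<in>{1..p}. a i = 0)" using x0 by blast
  qed
qed

section \<open>The absence of real vectors in \<open>D\<close>\<close>

lemma p_eq_0_iff: "p = 0 \<longleftrightarrow> D = cvec.span (w ` {1..q})"
proof
  assume "p = 0"
  then show "D = cvec.span (w ` {1..q})" using D_span by simp
next
  assume D: "D = cvec.span (w ` {1..q})"
  show "p = 0"
  proof (rule ccontr)
    assume "p \<noteq> 0"
    then have one: "1 \<in> {1..p}" by simp
    \<comment> \<open>Pairing with \<open>v' 1\<close> separates \<open>v 1\<close>, where it is 1,
      from the span of the \<open>w j\<close>, where it vanishes.\<close>
    have "cbilin b z (of_vec (v' 1)) = 0" if "z \<in> D" for z
      using that unfolding D
      by (induction rule: cvec.span_induct_alt)
        (use one in \<open>auto simp: cbilin_0_left[OF bil] cbil_left pairings_vw\<close>)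
    moreover have "of_vec (v 1) \<in> D"
      unfolding D_span using one by (auto intro!: cvec.span_base)
    ultimately show False using pairings_v(3)[OF one one] by simp
  qed
qed

text \<open>The reality criterion at \<open>X = 0\<close> forces every coefficient of
  \<open>w j\<close> in a real element of \<open>D\<close> to vanish; conversely, \<open>v 1\<close>
  would be a nonzero real element.\<close>

lemma p_eq_0_iff_no_real: "p = 0 \<longleftrightarrow> {r. of_vec r \<in> D} = {0}"
proof
  assume p: "p = 0"
  have "r = 0" if "of_vec r \<in> D" for r
  proof -
    obtain a c where r: "of_vec r = dvec a c" using D_imp_dvec[OF \<open>of_vec r \<in> D\<close>] .
    have "conj_vec (\<sigma> 0 + dvec a c) = \<sigma> 0 + dvec a c" using r sigma_0 by (metis add_0 conj_vec_simps(4))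
    then have "c j = 0" if "j \<in> {1..q}" for j
      using that sigma_dvec_real_iff[OF cvec.subspace_0[OF W]] lam_beta_0 by simp
    then have "of_vec r = 0" unfolding r dvec_def using p by simp
    then show ?thesis by (simp add: prod_eq_iff)
  qed
  moreover have "of_vec 0 \<in> D" unfolding D_span by (simp add: cvec.span_zero)
  ultimately show "{r. of_vec r \<in> D} = {0}" by blast
next
  assume D: "{r. of_vec r \<in> D} = {0}"
  show "p = 0"
  proof (rule ccontr)
    assume "p \<noteq> 0"
    then have one: "1 \<in> {1..p}" by simp
    have "of_vec (v 1) \<in> D"
      unfolding D_span using one by (auto intro!: cvec.span_base)
    then have "v 1 = 0" using D by blast
    then show False using pairings_v(3)[OF one one] by (simp add: cbilin_0_left[OF bil])
  qed
qed

end

section \<open>The equivalence and the parity of the dimension\<close>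

theorem proposition16:
  fixes b :: "'g::real_vector \<Rightarrow> 'g \<Rightarrow> real"
    and W :: "'v::real_vector cplx set"
    and D :: "'g cplx set"
    and \<sigma> :: "'v cplx \<Rightarrow> 'g cplx"
    and \<epsilon> :: "'v cplx \<Rightarrow> 'v cplx \<Rightarrow> complex"
    and L :: "('v, 'g) esp set"
    and p q :: nat
    and v v' :: "nat \<Rightarrow> 'g"
    and w :: "nat \<Rightarrow> 'g cplx"
    and e :: "nat \<Rightarrow> real"
    and lam \<beta> :: "nat \<Rightarrow> 'v cplx \<Rightarrow> complex"
  assumes "\<exists>B :: 'v set. finite B \<and> span B = UNIV"
    and "\<exists>B :: 'g set. finite B \<and> span B = UNIV"
    and "is_scalar_product b" and "neutral_signature b"
    and "cvec.subspace W"
    and "dirac_structure UNIV cscale (cbilin b) D"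
    and "clinear_on W cscale \<sigma>"
    and "alternating_form_on W \<epsilon>"
    and "L = Ldirac b W D \<sigma> \<epsilon>"
    and "dirac_structure ecarrier escale (eform b) L"
    and "adapted_basis b D p q v w v' e"
    and "\<And>i. i \<in> {1..p} \<Longrightarrow> clinear_on W (*) (lam i)"
    and "\<And>j. j \<in> {1..q} \<Longrightarrow> clinear_on W (*) (\<beta> j)"
    and "\<And>X. X \<in> W \<Longrightarrow> \<sigma> X = (\<Sum>i = 1..p. cscale (lam i X) (of_vec (v' i)))
                                 + (\<Sum>j = 1..q. cscale (\<beta> j X) (conj_vec (w j)))"
  shows "(real_index_zero L \<longleftrightarrow>
            {X + Y | X Y. X \<in> W \<and> Y \<in> conj_vec ` W} = UNIV \<and>
            (Delta W = {0} \<and> D = cvec.span (w ` {1..q}) \<or>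
             Delta W \<noteq> {0} \<and>
             independent_forms_on (Delta W) p (\<lambda>i x. Im (lam i (of_vec x))) \<and>
             nondegenerate_on (Delta0 W p lam) (omega q e \<epsilon> \<beta>))) \<and>
         (D = cvec.span (w ` {1..q}) \<longleftrightarrow> {r. of_vec r \<in> D} = {0}) \<and>
         (Delta W \<noteq> {0} \<and>
          independent_forms_on (Delta W) p (\<lambda>i x. Im (lam i (of_vec x))) \<and>
          nondegenerate_on (Delta0 W p lam) (omega q e \<epsilon> \<beta>) \<longrightarrow>
          even (dim (Delta0 W p lam)))"
proof -
  interpret adapted_dirac b W D \<sigma> \<epsilon> p q v v' w e lam \<beta>
    by unfold_locales (use assms in auto)
  let ?I = "independent_forms_on (Delta W) p (\<lambda>i x. Im (lam i (of_vec x)))"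
  let ?G = "nondegenerate_on (Delta0 W p lam) (omega q e \<epsilon> \<beta>)"
  have "evec.subspace L"
    using assms(10) by (simp add: dirac_structure_def isotropic_subspace_def)
  then have "real_index_zero L \<longleftrightarrow> fst ` W = UNIV \<and> ?I \<and> ?G"
    unfolding assms(9) no_solution_iff[symmetric] by (rule real_index_zero_iff_no_solution)
  \<comment> \<open>Case i) is the same pair of conditions at \<Delta> = 0: there all forms are
    zero, so independence means \<open>p = 0\<close>, and nondegeneracy is automatic.\<close>
  moreover have "?I \<and> ?G \<longleftrightarrow> p = 0" if "Delta W = {0}"
  proof -
    have "?I \<longleftrightarrow> p = 0"
    proof
      assume ?I
      then have "\<forall>i\<in>{1..p}. (1 :: real) = 0"
        unfolding independent_forms_on_def that
        by (elim allE[of _ "\<lambda>_. 1"]) (simp add: lam_beta_0)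
      then have "1 \<notin> {1..p}" by auto
      then show "p = 0" by simp
    qed (simp add: independent_forms_on_def)
    moreover have ?G using that by (auto simp: nondegenerate_on_def Delta0_def)
    ultimately show ?thesis by blast
  qed
  ultimately have index: "real_index_zero L \<longleftrightarrow> fst ` W = UNIV \<and>
      (Delta W = {0} \<and> p = 0 \<or> Delta W \<noteq> {0} \<and> ?I \<and> ?G)"
    by blast
  have even_dim: "even (dim (Delta0 W p lam))" if ?G
  proof -
    obtain B :: "'v set" where B: "finite B" "span B = UNIV" using assms(1) by blast
    have sub: "Delta0 W p lam \<subseteq> Delta W" by (auto simp: Delta0_def)
    \<comment> \<open>The dimension lemma takes a real-valued form; \<omega> takes real values, so
      it vanishes exactly when its real part does.\<close>
    show ?thesis
    proof (rule skew_nondegenerate_even_dim[OF subspace_Delta0 B(1)])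
      show "Delta0 W p lam \<subseteq> span B" using B by simp
      show "rlinear_on (Delta0 W p lam) (\<lambda>y. Re (omega q e \<epsilon> \<beta> x y))"
        if "x \<in> Delta0 W p lam" for x
        using that sub rlinear_on_omega rlinear_on_subset by blast
      show "Re (omega q e \<epsilon> \<beta> x y) = - Re (omega q e \<epsilon> \<beta> y x)"
        if "x \<in> Delta0 W p lam" "y \<in> Delta0 W p lam" for x y
        using that sub omega_skew by (metis subsetD uminus_complex.sel(1))
      show "x = 0" if "x \<in> Delta0 W p lam"
        "\<And>y. y \<in> Delta0 W p lam \<Longrightarrow> Re (omega q e \<epsilon> \<beta> x y) = 0" for x
        using that \<open>?G\<close> by (simp add: nondegenerate_on_def omega_eq_0_iff)
    qed
  qed
  show ?thesis
    unfolding sum_conj_eq_UNIV_iff[OF W] index p_eq_0_iff[symmetric] p_eq_0_iff_no_real[symmetric]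
    using even_dim by blast
qed

end
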